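(* Let $A:X\to Y$ be an injective bounded linear operator with non-closed range between Hilbert spaces. Let $\Psi(\lambda)$, $0<\lambda<\infty$, be a concave and strictly increasing index function satisfying $\lim_{\lambda\to+0}\Psi(\lambda)=0$, $\lim_{\lambda\to\infty}\Psi(\lambda)=\infty$ and $\lim_{\lambda\to\infty}\Psi(\lambda)/\lambda=0$, and let $\chi$ be an index function satisfying $$\chi(\lambda)\ge\Psi^{-1}(\lambda)/\lambda,\qquad 0<\lambda<\infty .$$ Let $X_\chi$ be the element with index $\chi$ of the variable Hilbert scale generated by $T=(A^*A)^{-1}$, and let $M=B_\chi(R)$ with $R>0$. Then $$\omega(M,\delta)\le\delta\sqrt{\Psi\left(\frac{R^2}{\delta^2}\right)},\qquad\delta>0 .$$
   Context: $X$ and $Y$ are infinite dimensional separable Hilbert spaces, with norms denoted $\|\cdot\|$. An index function is a continuous function $(0,\infty)\to(0,\infty)$. For an index function $\nu$, $X_\nu$ is the closure (completion) of the domain of the quadratic form $\|h\|_\nu^2=(h,\nu(T)h)$, with norm $\|\cdot\|_\nu$ ($\nu(T)$ defined by the spectral calculus). $B_\chi(R)=\{h\in X_\chi:\ \|h\|_\chi\le R\}$. For $M\subseteq X$ and $\delta>0$, the modulus of continuity of $A^{-1}$ restricted to $AM$ is $\omega(M,\delta)=\sup\{\|x\|:\ x\in M,\ \|Ax\|\le\delta\}$. *)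

theory Defs
  imports "HOL-Analysis.Analysis"
begin

(* Possibly unbounded operators are represented by their graphs.  The choice in op_apply is
   unique whenever the graph is single-valued. *)

type_synonym 'a operator = "('a \<times> 'a) set"

definition op_apply :: "'a operator \<Rightarrow> 'a \<Rightarrow> 'a" where
  "op_apply G x = (SOME y. (x, y) \<in> G)"

definition normal_operator_inverse ::
    "('a::real_inner \<Rightarrow> 'b::real_inner) \<Rightarrow> 'a operator" where
  "normal_operator_inverse A = {(adjoint A (A x), x) | x. True}"

definition orthogonal_projection :: "('a::real_inner \<Rightarrow> 'a) \<Rightarrow> bool" where
  "orthogonal_projection P \<longleftrightarrow>
     bounded_linear P \<and> P \<circ> P = P \<and> (\<forall>x y. P x \<bullet> y = x \<bullet> P y)"

definition projection_valued_measure :: "(real set \<Rightarrow> 'a::real_inner \<Rightarrow> 'a) \<Rightarrow> bool" where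
  "projection_valued_measure E \<longleftrightarrow>
     (\<forall>B\<in>sets borel. orthogonal_projection (E B)) \<and>
     E UNIV = id \<and>
     (\<forall>B::nat \<Rightarrow> real set. range B \<subseteq> sets borel \<longrightarrow> disjoint_family B \<longrightarrow>
        (\<forall>x. (\<lambda>i. E (B i) x) sums E (\<Union>i. B i) x))"

definition diagonal_measure ::
    "(real set \<Rightarrow> 'a::real_inner \<Rightarrow> 'a) \<Rightarrow> 'a \<Rightarrow> real measure" where
  "diagonal_measure E x = measure_of UNIV (sets borel) (\<lambda>B. ennreal (E B x \<bullet> x))"

definition spectral_integral_domain ::
    "(real set \<Rightarrow> 'a::real_inner \<Rightarrow> 'a) \<Rightarrow> (real \<Rightarrow> real) \<Rightarrow> 'a set" where
  "spectral_integral_domain E f = {x. integrable (diagonal_measure E x) (\<lambda>t. (f t)\<^sup>2)}"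

(* The operator "integral of f dE" (for Borel f), given weakly by
     (y, z) = integral of f d(E x, z).
   The signed measure (E x, z) is split by polarization into the measures of x + z and x - z.
   Letting z range over the (dense) domain of the operator suffices to determine y and makes
   f integrable for both measures. *)

definition spectral_integral ::
    "(real set \<Rightarrow> 'a::real_inner \<Rightarrow> 'a) \<Rightarrow> (real \<Rightarrow> real) \<Rightarrow> 'a operator" where
  "spectral_integral E f =
     {(x, y). x \<in> spectral_integral_domain E f \<and>
        (\<forall>z\<in>spectral_integral_domain E f.
           y \<bullet> z = ((\<integral>t. f t \<partial>diagonal_measure E (x + z)) -
                    (\<integral>t. f t \<partial>diagonal_measure E (x - z))) / 4)}"

definition spectral_measure_of ::
    "(real set \<Rightarrow> 'a::real_inner \<Rightarrow> 'a) \<Rightarrow> 'a operator \<Rightarrow> bool" where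
  "spectral_measure_of E T \<longleftrightarrow>
     projection_valued_measure E \<and> spectral_integral E (\<lambda>t. t) = T"

definition index_function :: "(real \<Rightarrow> real) \<Rightarrow> bool" where
  "index_function \<nu> \<longleftrightarrow> continuous_on {0<..} \<nu> \<and> (\<forall>t>0. \<nu> t > 0)"

(* The graph of nu(T) for a strictly positive self-adjoint operator T.  The spectral measure of T
   exists, is unique on Borel sets and is carried by the open half-line; hence cutting nu off
   outside of (0, oo), where an index function has no meaningful values, changes nothing, and the
   existential quantifier refers to one spectral measure only. *)

definition spectral_calculus ::
    "(real \<Rightarrow> real) \<Rightarrow> 'a::real_inner operator \<Rightarrow> 'a operator" where
  "spectral_calculus \<nu> T =
     {(x, y). \<exists>E. spectral_measure_of E T \<and>
        (x, y) \<in> spectral_integral E (\<lambda>t. indicator {0<..} t * \<nu> t)}"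

definition form_norm :: "'a::real_inner operator \<Rightarrow> (real \<Rightarrow> real) \<Rightarrow> 'a \<Rightarrow> real" where
  "form_norm T \<nu> h = sqrt (h \<bullet> op_apply (spectral_calculus \<nu> T) h)"

(* X_nu is the completion of the domain of the form with respect to form_norm, as far as it is
   realised inside X: x belongs to it if x is the limit in X of a form_norm-Cauchy sequence h of
   the domain, and its norm is then the limit of the norms of the h n.  The form being closable,
   this limit does not depend on h.  For nu bounded away from 0 on the spectrum of T, form_norm
   dominates the norm of X and this is the whole completion. *)

definition has_scale_norm ::
    "'a::real_inner operator \<Rightarrow> (real \<Rightarrow> real) \<Rightarrow> 'a \<Rightarrow> real \<Rightarrow> bool" where
  "has_scale_norm T \<nu> x r \<longleftrightarrow>
     (\<exists>h::nat \<Rightarrow> 'a.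
        (\<forall>n. h n \<in> Domain (spectral_calculus \<nu> T)) \<and>
        (\<forall>e>0. \<exists>N. \<forall>m\<ge>N. \<forall>n\<ge>N. form_norm T \<nu> (h m - h n) < e) \<and>
        h \<longlonglongrightarrow> x \<and>
        (\<lambda>n. form_norm T \<nu> (h n)) \<longlonglongrightarrow> r)"

definition scale_space :: "'a::real_inner operator \<Rightarrow> (real \<Rightarrow> real) \<Rightarrow> 'a set" where
  "scale_space T \<nu> = {x. \<exists>r. has_scale_norm T \<nu> x r}"

definition scale_norm :: "'a::real_inner operator \<Rightarrow> (real \<Rightarrow> real) \<Rightarrow> 'a \<Rightarrow> real" where
  "scale_norm T \<nu> x = (SOME r. has_scale_norm T \<nu> x r)"

definition scale_ball :: "'a::real_inner operator \<Rightarrow> (real \<Rightarrow> real) \<Rightarrow> real \<Rightarrow> 'a set" where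
  "scale_ball T \<nu> R = {h \<in> scale_space T \<nu>. scale_norm T \<nu> h \<le> R}"

(* Extended-real valued, so that the supremum of an unbounded set is infinite. *)

definition modulus_of_continuity ::
    "('a::real_normed_vector \<Rightarrow> 'b::real_normed_vector) \<Rightarrow> 'a set \<Rightarrow> real \<Rightarrow> ereal" where
  "modulus_of_continuity A M \<delta> = (SUP x\<in>{x \<in> M. norm (A x) \<le> \<delta>}. ereal (norm x))"

definition infinite_dimensional :: "'a::real_vector itself \<Rightarrow> bool" where
  "infinite_dimensional _ \<longleftrightarrow> \<not> (\<exists>B::'a set. finite B \<and> span B = UNIV)"

end

theory Submission
  imports Defs
begin

text \<open>Put \<open>s = R\<^sup>2 / \<delta>\<^sup>2\<close> and let \<open>a + k t\<close> be a supporting line of \<open>\<Psi>\<close> at \<open>s\<close>; monotonicity and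
  positivity of \<open>\<Psi>\<close> force \<open>a, k \<ge> 0\<close>. Substituting \<open>\<lambda> = \<Psi> t\<close> and using the lower bound on the index
  function gives \<open>1 \<le> a / \<lambda> + k chi \<lambda>\<close> for all \<open>\<lambda> > 0\<close>. Integrating against the spectral measure of
  \<open>T\<close> at \<open>h\<close> yields \<open>\<parallel>h\<parallel>\<^sup>2 \<le> a \<parallel>A h\<parallel>\<^sup>2 + k (form_norm T chi h)\<^sup>2\<close>, which survives
  the limit to the completion and is at most \<open>a \<delta>\<^sup>2 + k R\<^sup>2 = \<delta>\<^sup>2 \<Psi> s\<close> for \<open>\<parallel>A h\<parallel> \<le> \<delta>\<close> in the ball.

  Neither existence nor uniqueness of the spectral measure matters: without one the ball is empty,
  and the estimate for a single \<open>h\<close> holds for any \<open>E\<close> representing \<open>T\<close>. The missing link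
  \<open>\<integral> 1 / \<lambda> d(E h, h) = \<parallel>A h\<parallel>\<^sup>2\<close> is obtained from the weak definition of the spectral integral:
  \<open>A\<^sup>* A\<close> commutes with \<open>E\<close>, and \<open>(E h, h)\<close> has density \<open>\<lambda>\<close> with respect to the positive measure
  \<open>(E h, A\<^sup>* A h)\<close>.\<close>

section \<open>Integrals against linear combinations of measures\<close>

lemma tendsto_sum_list:
  fixes g :: "'i \<Rightarrow> 'j \<Rightarrow> 'c::topological_monoid_add"
  assumes "\<And>p. p \<in> set L \<Longrightarrow> ((\<lambda>i. g i p) \<longlongrightarrow> h p) F"
  shows "((\<lambda>i. \<Sum>p\<leftarrow>L. g i p) \<longlongrightarrow> (\<Sum>p\<leftarrow>L. h p)) F"
  using assms by (induction L) (auto intro!: tendsto_add)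

lemma integral_simple_function:
  fixes g :: "'a \<Rightarrow> real"
  assumes "finite_measure M" and g: "simple_function M g"
  shows "integral\<^sup>L M g = (\<Sum>y\<in>g ` space M. y * measure M (g -` {y} \<inter> space M))"
proof -
  interpret finite_measure M by fact
  have fin: "finite (g ` space M)" and [measurable]: "\<And>y. g -` {y} \<inter> space M \<in> sets M"
    using g by (auto simp: simple_functionD)
  have "integral\<^sup>L M g = (\<integral>x. (\<Sum>y\<in>g ` space M. y * indicator (g -` {y} \<inter> space M) x) \<partial>M)"
  proof (rule Bochner_Integration.integral_cong[OF refl])
    fix x assume x: "x \<in> space M"
    have "(\<Sum>y\<in>g ` space M. y * indicator (g -` {y} \<inter> space M) x)
        = (\<Sum>y\<in>g ` space M. if y = g x then g x else 0)"
      using x by (intro sum.cong) (auto simp: indicator_def)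
    then show "g x = (\<Sum>y\<in>g ` space M. y * indicator (g -` {y} \<inter> space M) x)"
      using fin x by simp
  qed
  also have "\<dots> = (\<Sum>y\<in>g ` space M. y * measure M (g -` {y} \<inter> space M))"
    by (subst Bochner_Integration.integral_sum) (auto intro!: integrable_mult_right integrable_real_indicator emeasure_finite simp: less_top[symmetric])
  finally show ?thesis .
qed

text \<open>Lists of coefficients and measures stand for the signed measures that arise from
  polarization. The approximating simple functions are bounded by twice the absolute value of
  \<open>f\<close>, so dominated convergence applies to each entry; for a simple function the
  integrals reduce to the vanishing combinations on level sets.\<close>

lemma sum_list_integral_eq_0:
  fixes f :: "'a \<Rightarrow> real"
  assumes L: "\<And>c M. (c, M) \<in> set L \<Longrightarrow> finite_measure M \<and> sets M = sets N \<and> integrable M f"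
    and f: "f \<in> borel_measurable N"
    and eq: "\<And>B. B \<in> sets N \<Longrightarrow> (\<Sum>p\<leftarrow>L. fst p * measure (snd p) B) = 0"
  shows "(\<Sum>p\<leftarrow>L. fst p * integral\<^sup>L (snd p) f) = 0"
proof -
  obtain F where F: "\<And>i. simple_function N (F i)" 
    "\<And>x. x \<in> space N \<Longrightarrow> (\<lambda>i. F i x) \<longlonglongrightarrow> f x"
    "\<And>i x. x \<in> space N \<Longrightarrow> dist (F i x) 0 \<le> 2 * dist (f x) 0"
    using borel_measurable_implies_sequence_metric[OF f, of 0] by blast
  define S where "S i = F i ` space N" for i
  define B where "B i y = F i -` {y} \<inter> space N" for i y
  have B: "B i y \<in> sets N" for i y
    using F(1)[of i] by (auto simp: B_def simple_functionD)
  have "(\<lambda>i. \<Sum>p\<leftarrow>L. fst p * integral\<^sup>L (snd p) (F i)) \<longlonglongrightarrow> (\<Sum>p\<leftarrow>L. fst p * integral\<^sup>L (snd p) f)"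
  proof (rule tendsto_sum_list, rule tendsto_mult_left)
    fix p assume p: "p \<in> set L"
    have fm: "sets (snd p) = sets N" "integrable (snd p) f"
      using L[of "fst p" "snd p"] p by auto
    have sp: "space (snd p) = space N" using fm(1) by (rule sets_eq_imp_space_eq)
    have "F i \<in> borel_measurable (snd p)" for i
      using borel_measurable_simple_function[OF F(1)] measurable_cong_sets[OF fm(1) refl] by blast
    then show "(\<lambda>i. integral\<^sup>L (snd p) (F i)) \<longlonglongrightarrow> integral\<^sup>L (snd p) f"
      using fm(2) F(2,3)
      by (intro integral_dominated_convergence[where w="\<lambda>x. 2 * norm (f x)"])
        (auto simp: sp dist_norm)
  qed
  moreover have "(\<Sum>p\<leftarrow>L. fst p * integral\<^sup>L (snd p) (F i)) = 0" for i
  proof -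
    have "integral\<^sup>L (snd p) (F i) = (\<Sum>y\<in>S i. y * measure (snd p) (B i y))" if "p \<in> set L" for p
    proof -
      have fm: "sets (snd p) = sets N" "finite_measure (snd p)"
        using L[of "fst p" "snd p"] that by auto
      have sp: "space (snd p) = space N" using fm(1) by (rule sets_eq_imp_space_eq)
      have "simple_function (snd p) (F i)"
        using F(1) simple_function_cong_algebra[OF fm(1) sp] by blast
      from integral_simple_function[OF fm(2) this] show ?thesis
        by (simp add: S_def B_def sp)
    qed
    then have "(\<Sum>p\<leftarrow>L. fst p * integral\<^sup>L (snd p) (F i))
      = (\<Sum>p\<leftarrow>L. fst p * (\<Sum>y\<in>S i. y * measure (snd p) (B i y)))"
      by (intro arg_cong[where f=sum_list] map_cong) auto
    also have "\<dots> = (\<Sum>y\<in>S i. y * (\<Sum>p\<leftarrow>L. fst p * measure (snd p) (B i y)))"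
      by (induction L) (auto simp: algebra_simps sum.distrib sum_distrib_left)
    also have "\<dots> = 0" using eq[OF B] by simp
    finally show ?thesis .
  qed
  ultimately show ?thesis by (simp add: LIMSEQ_const_iff)
qed

text \<open>A nonnegative integral is a supremum of integrals of simple functions, and for these the
  setwise bound applies on each level set.\<close>

lemma nn_integral_le_sum_measure:
  assumes sets: "sets M = sets N1" "sets M = sets N2"
    and le: "\<And>B. B \<in> sets M \<Longrightarrow> emeasure M B \<le> c * emeasure N1 B + d * emeasure N2 B"
  shows "integral\<^sup>N M f \<le> c * integral\<^sup>N N1 f + d * integral\<^sup>N N2 f"
  unfolding nn_integral_def[of M]
proof (rule SUP_least)
  fix g assume "g \<in> {g. simple_function M g \<and> g \<le> f}"
  then have g: "simple_function M g" "g \<le> f" by auto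
  have sp: "space N1 = space M" "space N2 = space M"
    using sets by (auto dest: sets_eq_imp_space_eq)
  have g1: "simple_function N1 g" "simple_function N2 g"
    using g sets sp by (auto simp: simple_function_def)
  have "integral\<^sup>S M g = (\<Sum>y\<in>g ` space M. y * emeasure M (g -` {y} \<inter> space M))"
    by (simp add: simple_integral_def)
  also have "\<dots> \<le> (\<Sum>y\<in>g ` space M. y * (c * emeasure N1 (g -` {y} \<inter> space M) + d * emeasure N2 (g -` {y} \<inter> space M)))"
    using g by (intro sum_mono mult_left_mono le) (auto simp: simple_functionD)
  also have "\<dots> = c * integral\<^sup>S N1 g + d * integral\<^sup>S N2 g"
    by (simp add: simple_integral_def sp sum_distrib_left sum.distrib distrib_left ac_simps)
  also have "\<dots> \<le> c * integral\<^sup>N N1 f + d * integral\<^sup>N N2 f"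
    unfolding nn_integral_def using g g1
    by (intro add_mono mult_left_mono SUP_upper) auto
  finally show "integral\<^sup>S M g \<le> c * integral\<^sup>N N1 f + d * integral\<^sup>N N2 f" .
qed

text \<open>Constants are integrable over a finite measure and
  \<open>\<bar>s\<bar> \<le> 1 + s\<^sup>2\<close>. Domains of spectral integrals ask for square
  integrability, while the weak formula integrates \<open>f\<close> itself.\<close>

lemma integrable_of_square_integrable:
  fixes f :: "'a \<Rightarrow> real"
  assumes "finite_measure M" and [measurable]: "f \<in> borel_measurable M"
    and "integrable M (\<lambda>t. (f t)\<^sup>2)"
  shows "integrable M f"
proof (rule Bochner_Integration.integrable_bound[where f="\<lambda>t. 1 + (f t)\<^sup>2"])
  interpret finite_measure M by fact
  show "integrable M (\<lambda>t. 1 + (f t)\<^sup>2)" using assms(3) by simp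
  have "\<bar>s\<bar> \<le> 1 + s\<^sup>2" for s :: real
    using zero_le_power2[of "\<bar>s\<bar> - 1"] unfolding power2_diff power2_abs by simp
  then have "\<bar>f t\<bar> \<le> \<bar>1 + (f t)\<^sup>2\<bar>" for t by (rule order_trans) simp
  then show "AE t in M. norm (f t) \<le> norm (1 + (f t)\<^sup>2)" unfolding real_norm_def by (rule AE_I2)
qed simp

section \<open>Adjoints on Hilbert spaces\<close>

theorem riesz_representation:
  fixes f :: "'a::{real_inner, complete_space} \<Rightarrow> real"
  assumes "bounded_linear f"
  shows "\<exists>y. \<forall>x. f x = x \<bullet> y"
proof -
  interpret f: bounded_linear f by fact
  \<comment> \<open>The representing vector is the minimizer of \<open>\<phi>\<close>, whose minimizing sequences are Cauchy by the
    parallelogram law.\<close>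
  define \<phi> where "\<phi> x = (norm x)\<^sup>2 - 2 * f x" for x
  obtain K where K: "\<And>x. norm (f x) \<le> norm x * K"
    using f.bounded by blast
  have lower: "- K\<^sup>2 \<le> \<phi> x" for x
  proof -
    have "0 \<le> (norm x - K)\<^sup>2" by simp
    moreover have "f x \<le> norm x * K" using K[of x] by simp
    ultimately show ?thesis unfolding \<phi>_def by (simp add: power2_diff)
  qed
  define m where "m = Inf (range \<phi>)"
  have bdd: "bdd_below (range \<phi>)" using lower by (auto intro!: bdd_belowI)
  have m: "m \<le> \<phi> x" for x unfolding m_def using bdd by (auto intro: cInf_lower)
  have par: "\<phi> x + \<phi> y = 2 * \<phi> ((1/2) *\<^sub>R (x + y)) + (norm (x - y))\<^sup>2 / 2" for x y
    unfolding \<phi>_def by (simp add: power2_norm_eq_inner f.add f.scaleR inner_add inner_diff inner_commute field_simps)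
  have dist: "(norm (x - y))\<^sup>2 \<le> 2 * (\<phi> x - m) + 2 * (\<phi> y - m)" for x y
    using par[of x y] m[of "(1/2) *\<^sub>R (x + y)"] by simp
  have "\<exists>x. \<phi> x < m + inverse (real (Suc n))" for n
    using cInf_lessD[of "range \<phi>" "m + inverse (real (Suc n))"] by (auto simp: m_def)
  then obtain s where s: "\<And>n. \<phi> (s n) < m + inverse (real (Suc n))" by metis
  have "Cauchy s"
  proof (rule CauchyI)
    fix e :: real assume e: "0 < e"
    define d where "d n = inverse (real (Suc n))" for n
    obtain M where "inverse (real (Suc M)) < e\<^sup>2 / 4"
      using reals_Archimedean[of "e\<^sup>2 / 4"] e by auto
    then have M: "4 * d M < e\<^sup>2" by (simp add: d_def)
    have "norm (s i - s j) < e" if "i \<ge> M" "j \<ge> M" for i j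
    proof -
      have "d i \<le> d M" "d j \<le> d M"
        using that by (auto simp: d_def intro!: le_imp_inverse_le)
      moreover have "\<phi> (s i) < m + d i" "\<phi> (s j) < m + d j" using s by (auto simp: d_def)
      ultimately have "2 * (\<phi> (s i) - m) + 2 * (\<phi> (s j) - m) < e\<^sup>2" using M by argo
      with dist[of "s i" "s j"] have "(norm (s i - s j))\<^sup>2 < e\<^sup>2" by (rule le_less_trans)
      then show ?thesis using e power2_less_imp_less by force
    qed
    then show "\<exists>M. \<forall>i\<ge>M. \<forall>j\<ge>M. norm (s i - s j) < e" by blast
  qed
  then obtain y where y: "s \<longlonglongrightarrow> y" using Cauchy_convergent convergent_def by blast
  have "(\<lambda>n. \<phi> (s n)) \<longlonglongrightarrow> \<phi> y"
    unfolding \<phi>_def by (intro tendsto_intros f.tendsto y)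
  moreover have "(\<lambda>n. m + inverse (real (Suc n))) \<longlonglongrightarrow> m + 0"
    by (intro tendsto_add tendsto_const LIMSEQ_inverse_real_of_nat)
  ultimately have "\<phi> y \<le> m + 0"
    by (rule LIMSEQ_le) (use s less_imp_le in auto)
  then have min: "\<phi> y \<le> \<phi> x" for x using m[of x] by simp
  have "f x = x \<bullet> y" for x
  proof -
    define c where "c = x \<bullet> y - f x"
    define N where "N = (norm x)\<^sup>2"
    \<comment> \<open>The quadratic \<open>2 * t * c + t\<^sup>2 * N\<close> is smallest at
      \<open>- c / N\<close>; the added 1 admits \<open>N = 0\<close> and still gives a strictly
      negative value unless \<open>c = 0\<close>.\<close>
    define t where "t = - c / (N + 1)"
    have N: "N \<ge> 0" by (simp add: N_def)
    have "0 \<le> \<phi> (y + t *\<^sub>R x) - \<phi> y" using min by simp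
    also have "\<dots> = 2 * t * c + t\<^sup>2 * N"
    proof -
      have "(norm (y + t *\<^sub>R x))\<^sup>2 = (norm y)\<^sup>2 + 2 * t * (x \<bullet> y) + t\<^sup>2 * (norm x)\<^sup>2"
        unfolding power2_norm_eq_inner by (simp add: inner_add inner_commute power2_eq_square)
      then show ?thesis
        unfolding \<phi>_def c_def N_def by (simp add: f.add f.scaleR algebra_simps)
    qed
    also have "\<dots> = - (c\<^sup>2 * (N + 2) / (N + 1)\<^sup>2)"
      using N by (simp add: t_def power2_eq_square divide_simps) (simp add: algebra_simps)
    finally have "c\<^sup>2 * ((N + 2) / (N + 1)\<^sup>2) \<le> 0" by simp
    moreover have "(N + 2) / (N + 1)\<^sup>2 > 0" using N by simp
    ultimately have "c\<^sup>2 \<le> 0"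
      unfolding mult_le_0_iff by auto
    then show ?thesis by (simp add: c_def)
  qed
  then show ?thesis by blast
qed

text \<open>\<open>adjoint\<close> is a choice among the maps satisfying this identity; the Riesz
  theorem shows that there is one to choose.\<close>

lemma inner_adjoint:
  fixes A :: "'a::{real_inner, complete_space} \<Rightarrow> 'b::real_inner"
  assumes "bounded_linear A"
  shows "x \<bullet> adjoint A y = A x \<bullet> y"
proof -
  have "bounded_linear (\<lambda>x. A x \<bullet> y)" for y
    by (rule bounded_linear_compose[OF bounded_linear_inner_left assms])
  then have "\<forall>y. \<exists>w. \<forall>x. A x \<bullet> y = x \<bullet> w" using riesz_representation by blast
  then have "\<exists>g. \<forall>x y. A x \<bullet> y = x \<bullet> g y" by metis
  then have "\<forall>x y. A x \<bullet> y = x \<bullet> adjoint A y"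
    unfolding adjoint_def by (rule someI_ex)
  then show ?thesis by simp
qed

section \<open>Index functions\<close>

lemma concave_supporting_line:
  fixes \<Psi> :: "real \<Rightarrow> real"
  assumes conc: "concave_on {0<..} \<Psi>" and mono: "strict_mono_on {0<..} \<Psi>"
    and pos: "\<And>t. t > 0 \<Longrightarrow> \<Psi> t > 0" and s: "s > 0"
  obtains a k where "a \<ge> 0" "k \<ge> 0" "a + k * s = \<Psi> s" "\<And>t. t > 0 \<Longrightarrow> \<Psi> t \<le> a + k * t"
proof -
  obtain k where k: "\<And>t. t > 0 \<Longrightarrow> \<Psi> t \<le> \<Psi> s + k * (t - s)"
  proof -
    have "\<exists>k. \<forall>t>0. - \<Psi> t \<ge> - \<Psi> s + k * (t - s)"
      using convex_le_Inf_differential[of "{0<..}" "\<lambda>t. - \<Psi> t" s] conc s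
      unfolding concave_on_def by (auto simp: interior_open)
    then obtain k where "\<forall>t>0. - \<Psi> t \<ge> - \<Psi> s + k * (t - s)" by blast
    then have "\<And>t. t > 0 \<Longrightarrow> \<Psi> t \<le> \<Psi> s + (- k) * (t - s)" by force
    then show ?thesis by (rule that)
  qed
  have "\<Psi> s < \<Psi> (s + 1)" using mono s by (intro strict_mono_onD[OF mono]) auto
  then have k0: "k \<ge> 0" using k[of "s + 1"] s by simp
  \<comment> \<open>The intercept is the limit at 0 of a line dominating a positive function. Since
    0 lies outside the domain of concavity, it is approached through small \<open>t\<close> with
    \<open>k * t \<le> e\<close>; the denominator \<open>k + 1\<close> covers
    \<open>k = 0\<close>.\<close>
  have a0: "\<Psi> s - k * s \<ge> 0"
  proof (rule field_le_epsilon)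
    fix e :: real assume e: "e > 0"
    define t where "t = e / (k + 1)"
    have t: "t > 0" using e k0 by (simp add: t_def)
    have "k * t \<le> e" using e k0 by (simp add: t_def field_simps)
    then show "0 \<le> \<Psi> s - k * s + e" using pos[OF t] k[OF t] by (simp add: algebra_simps)
  qed
  show ?thesis
    by (rule that[OF a0 k0]) (use k in \<open>auto simp: algebra_simps\<close>)
qed

text \<open>The limits at both ends and the intermediate value theorem show that
  \<open>\<Psi>\<close> takes every positive value. The bound on \<open>chi\<close> can therefore be
  read at \<open>\<Psi> t\<close> with the inverse evaluated inside its range.\<close>

lemma index_function_surj:
  assumes idx: "index_function \<Psi>" and lim0: "(\<Psi> \<longlongrightarrow> 0) (at_right 0)"
    and liminf: "filterlim \<Psi> at_top at_top" and l: "l > 0"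
  obtains t where "t > 0" "\<Psi> t = l"
proof -
  have cont: "continuous_on {0<..} \<Psi>" using idx by (simp add: index_function_def)
  have "eventually (\<lambda>t. \<Psi> t < l) (at_right 0)" using order_tendstoD(2)[OF lim0 l] .
  then obtain b where b: "b > 0" "\<And>t. 0 < t \<Longrightarrow> t < b \<Longrightarrow> \<Psi> t < l"
    unfolding eventually_at_right_field by auto
  have "eventually (\<lambda>t. l \<le> \<Psi> t) at_top" using liminf by (simp add: filterlim_at_top)
  then obtain c where c: "\<And>t. t \<ge> c \<Longrightarrow> l \<le> \<Psi> t" by (auto simp: eventually_at_top_linorder)
  \<comment> \<open>The estimate near 0 holds only strictly below \<open>b\<close>, hence the left
    endpoint \<open>b / 2\<close>; the right endpoint has to lie beyond both it and
    \<open>c\<close>.\<close>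
  have "\<exists>t\<ge>b/2. t \<le> max b c \<and> \<Psi> t = l"
  proof (rule IVT')
    show "\<Psi> (b / 2) \<le> l" using b by (simp add: less_imp_le)
    show "l \<le> \<Psi> (max b c)" using c by simp
    show "b / 2 \<le> max b c" using b by simp
    show "continuous_on {b / 2..max b c} \<Psi>" using b by (intro continuous_on_subset[OF cont]) auto
  qed
  then obtain t where "t \<ge> b/2" "\<Psi> t = l" by blast
  with b(1) show ?thesis by (intro that[of t]) auto
qed

section \<open>Projection-valued measures\<close>

locale pvm =
  fixes E :: "real set \<Rightarrow> 'a::real_inner \<Rightarrow> 'a"
  assumes pvm: "projection_valued_measure E"
begin

abbreviation \<mu> :: "'a \<Rightarrow> real measure" where "\<mu> \<equiv> diagonal_measure E"

section \<open>Algebra of the projections\<close>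

lemma orthogonal_projection: "B \<in> sets borel \<Longrightarrow> orthogonal_projection (E B)"
  using pvm by (simp add: projection_valued_measure_def)

lemma bounded_linear_proj: "B \<in> sets borel \<Longrightarrow> bounded_linear (E B)"
  using orthogonal_projection by (auto simp: orthogonal_projection_def)

lemma proj_idem: "B \<in> sets borel \<Longrightarrow> E B (E B x) = E B x"
  using orthogonal_projection[of B] by (auto simp: orthogonal_projection_def fun_eq_iff)

lemma proj_sym: "B \<in> sets borel \<Longrightarrow> E B x \<bullet> y = x \<bullet> E B y"
  using orthogonal_projection[of B] by (auto simp: orthogonal_projection_def)

lemma proj_inner_self: "B \<in> sets borel \<Longrightarrow> E B x \<bullet> x = (norm (E B x))\<^sup>2"
  by (metis proj_idem proj_sym power2_norm_eq_inner)

lemma proj_UNIV [simp]: "E UNIV x = x"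
  using pvm by (simp add: projection_valued_measure_def)

lemma proj_sums:
  "range B \<subseteq> sets borel \<Longrightarrow> disjoint_family B \<Longrightarrow> (\<lambda>i. E (B i) x) sums E (\<Union>i::nat. B i) x"
  using pvm by (simp add: projection_valued_measure_def)

text \<open>Countable additivity over empty sets gives a convergent series with constant terms,
  which must vanish.\<close>

lemma proj_empty [simp]: "E {} x = 0"
proof -
  have "(\<lambda>i::nat. E {} x) sums E (\<Union>i::nat. {}) x"
    by (rule proj_sums) (auto simp: disjoint_family_on_def)
  then have "summable (\<lambda>i::nat. E {} x)" by (rule sums_summable)
  then have "(\<lambda>i::nat. E {} x) \<longlonglongrightarrow> 0" by (rule summable_LIMSEQ_zero)
  then show ?thesis by (simp add: LIMSEQ_const_iff)
qed

lemma proj_Un: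
  assumes "B \<in> sets borel" "C \<in> sets borel" "B \<inter> C = {}"
  shows "E (B \<union> C) x = E B x + E C x"
proof -
  have "(\<lambda>i. E (binaryset B C i) x) sums E (\<Union>i. binaryset B C i) x"
    using assms by (intro proj_sums) (auto simp: binaryset_def disjoint_family_on_def)
  moreover have "(\<lambda>i. E (binaryset B C i) x) sums (\<Sum>i\<in>{0,1}. E (binaryset B C i) x)"
    by (rule sums_finite) (auto simp: binaryset_def)
  ultimately show ?thesis
    by (simp add: UN_binaryset_eq sums_iff) (simp add: binaryset_def)
qed

lemma proj_contraction: "B \<in> sets borel \<Longrightarrow> norm (E B x) \<le> norm x"
  using norm_cauchy_schwarz[of "E B x" x] proj_inner_self[of B x]
  by (cases "E B x = 0") (auto simp: power2_eq_square)

text \<open>For \<open>y = E B x\<close>, which \<open>E B\<close> fixes, the squared norms of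
  \<open>E B y\<close> and \<open>E C y\<close> add up to at most that of \<open>y\<close>. The
  first already exhausts it, so nothing is left for \<open>E C y\<close>.\<close>

lemma proj_disjoint:
  assumes B: "B \<in> sets borel" and C: "C \<in> sets borel" and BC: "B \<inter> C = {}"
  shows "E C (E B x) = 0"
proof -
  define y where "y = E B x"
  have y: "E B y = y" using B by (simp add: y_def proj_idem)
  have "(norm (E B y))\<^sup>2 + (norm (E C y))\<^sup>2 = E (B \<union> C) y \<bullet> y"
    using assms by (simp add: proj_inner_self[symmetric] proj_Un inner_add_left)
  also have "\<dots> \<le> (norm y)\<^sup>2"
    using B C proj_inner_self[of "B \<union> C" y] proj_contraction[of "B \<union> C" y]
    by (simp add: power_mono)
  finally show ?thesis using y by (simp add: y_def)
qed

text \<open>Multiplicativity follows from additivity: \<open>E C\<close> kills the part of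
  \<open>E B x\<close> belonging to \<open>B - C\<close>, and on the part belonging to
  \<open>B \<inter> C\<close> the set \<open>C - B\<close> contributes nothing.\<close>

lemma proj_Int:
  assumes B: "B \<in> sets borel" and C: "C \<in> sets borel"
  shows "E C (E B x) = E (C \<inter> B) x"
proof -
  interpret EC: bounded_linear "E C" using C by (rule bounded_linear_proj)
  interpret ECB: bounded_linear "E (C \<inter> B)" using B C by (intro bounded_linear_proj) auto
  have 1: "E B x = E (B \<inter> C) x + E (B - C) x"
    using proj_Un[of "B \<inter> C" "B - C" x] B C by (simp add: Int_Diff_Un Int_Diff_disjoint)
  have 2: "E C (E (B - C) x) = 0" using B C by (intro proj_disjoint) auto
  have 3: "E C (E (B \<inter> C) x) = E (C \<inter> B) (E (B \<inter> C) x) + E (C - B) (E (B \<inter> C) x)"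
    using proj_Un[of "C \<inter> B" "C - B"] B C by (simp add: Int_Diff_Un Int_Diff_disjoint)
  have 4: "E (C - B) (E (B \<inter> C) x) = 0" using B C by (intro proj_disjoint) auto
  have 5: "E (C \<inter> B) (E (B \<inter> C) x) = E (C \<inter> B) x"
    using B C by (simp add: Int_commute proj_idem)
  show ?thesis using 1 2 3 4 5 EC.add by simp
qed

section \<open>Diagonal measures and polarization\<close>

lemma sets_diagonal_measure [measurable_cong]: "sets (\<mu> x) = sets borel"
  unfolding diagonal_measure_def using sets.sigma_sets_eq[of borel] by (simp add: sets_measure_of_conv)

lemma space_diagonal_measure [simp]: "space (\<mu> x) = UNIV"
  using sets_eq_imp_space_eq[OF sets_diagonal_measure] by simp

text \<open>Serves both the diagonal measure, with \<open>u = x\<close>, and the measure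
  \<open>\<kappa>\<close> below, with \<open>u = K x\<close>. Truncation of negative values by
  \<open>ennreal\<close> could destroy additivity, hence the sign assumption.\<close>

lemma emeasure_form_measure:
  assumes nonneg: "\<And>B. B \<in> sets borel \<Longrightarrow> 0 \<le> E B x \<bullet> u" and C: "C \<in> sets borel"
  shows "emeasure (measure_of UNIV (sets borel) (\<lambda>B. ennreal (E B x \<bullet> u))) C = ennreal (E C x \<bullet> u)"
proof (rule emeasure_measure_of_sigma[OF _ _ _ C])
  show "sigma_algebra UNIV (sets borel)"
    using sets.sigma_algebra_axioms[of borel] by simp
  show "positive (sets borel) (\<lambda>B. ennreal (E B x \<bullet> u))"
    by (simp add: positive_def)
  show "countably_additive (sets borel) (\<lambda>B. ennreal (E B x \<bullet> u))"
  proof (rule countably_additiveI)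
    fix B :: "nat \<Rightarrow> real set"
    assume B: "range B \<subseteq> sets borel" "disjoint_family B"
    have "(\<lambda>i. E (B i) x \<bullet> u) sums (E (\<Union>i. B i) x \<bullet> u)"
      by (rule bounded_linear.sums[OF bounded_linear_inner_left proj_sums[OF B]])
    then show "(\<Sum>i. ennreal (E (B i) x \<bullet> u)) = ennreal (E (\<Union>i. B i) x \<bullet> u)"
      using B by (subst suminf_ennreal2) (auto simp: sums_iff nonneg image_subset_iff)
  qed
qed

lemma emeasure_diagonal_measure:
  "B \<in> sets borel \<Longrightarrow> emeasure (\<mu> x) B = ennreal (E B x \<bullet> x)"
  unfolding diagonal_measure_def by (rule emeasure_form_measure) (simp_all add: proj_inner_self)

lemma finite_diagonal_measure: "finite_measure (\<mu> x)"
  by (rule finite_measureI) (simp add: emeasure_diagonal_measure)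

lemma measure_diagonal_measure:
  "B \<in> sets borel \<Longrightarrow> measure (\<mu> x) B = E B x \<bullet> x"
  by (simp add: measure_def emeasure_diagonal_measure proj_inner_self)

text \<open>Symmetry of \<open>E B\<close> merges the two cross terms. Together with the version for
  differences this expresses the signed measure \<open>E B x \<bullet> y\<close> through diagonal
  measures.\<close>

lemma measure_diagonal_add:
  assumes B: "B \<in> sets borel"
  shows "measure (\<mu> (x + y)) B = measure (\<mu> x) B + 2 * (E B x \<bullet> y) + measure (\<mu> y) B"
proof -
  interpret EB: bounded_linear "E B" using B by (rule bounded_linear_proj)
  show ?thesis using proj_sym[OF B, of x y] inner_commute[of x "E B y"]
    by (simp add: measure_diagonal_measure B EB.add inner_add)
qed

lemma measure_diagonal_diff:
  assumes B: "B \<in> sets borel"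
  shows "measure (\<mu> (x - y)) B = measure (\<mu> x) B - 2 * (E B x \<bullet> y) + measure (\<mu> y) B"
proof -
  interpret EB: bounded_linear "E B" using B by (rule bounded_linear_proj)
  show ?thesis using proj_sym[OF B, of x y] inner_commute[of x "E B y"]
    by (simp add: measure_diagonal_measure B EB.diff inner_diff)
qed

section \<open>Integrability and domains\<close>

lemma integrable_diagonal_mono:
  fixes f :: "real \<Rightarrow> real"
  assumes f: "f \<in> borel_measurable borel" and int: "integrable (\<mu> y) f" "integrable (\<mu> z) f"
    and cd: "c \<ge> 0" "d \<ge> 0"
    and le: "\<And>B. B \<in> sets borel \<Longrightarrow> measure (\<mu> x) B \<le> c * measure (\<mu> y) B + d * measure (\<mu> z) B"
  shows "integrable (\<mu> x) f"
proof (rule integrableI_bounded)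
  show "f \<in> borel_measurable (\<mu> x)" using f by simp
  have "emeasure (\<mu> x) B \<le> ennreal c * emeasure (\<mu> y) B + ennreal d * emeasure (\<mu> z) B"
    if "B \<in> sets (\<mu> x)" for B
    using le[of B] that cd
    by (simp add: finite_measure.emeasure_eq_measure[OF finite_diagonal_measure]
        sets_diagonal_measure ennreal_mult'[symmetric] ennreal_plus[symmetric] del: ennreal_plus)
  then have "(\<integral>\<^sup>+ t. norm (f t) \<partial>\<mu> x) \<le> ennreal c * (\<integral>\<^sup>+ t. norm (f t) \<partial>\<mu> y) + ennreal d * (\<integral>\<^sup>+ t. norm (f t) \<partial>\<mu> z)"
    by (intro nn_integral_le_sum_measure) (auto simp: sets_diagonal_measure)
  also have "\<dots> < \<infinity>"
    using int by (auto simp: integrable_iff_bounded ennreal_mult_less_top)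
  finally show "(\<integral>\<^sup>+ t. norm (f t) \<partial>\<mu> x) < \<infinity>" .
qed

text \<open>By the parallelogram law on each Borel set, both measures are dominated by twice the sum
  of those of \<open>y\<close> and \<open>z\<close>.\<close>

lemma integrable_diagonal_add_diff:
  fixes f :: "real \<Rightarrow> real"
  assumes f: "f \<in> borel_measurable borel" and int: "integrable (\<mu> y) f" "integrable (\<mu> z) f"
  shows "integrable (\<mu> (y + z)) f" "integrable (\<mu> (y - z)) f"
proof -
  have sum: "measure (\<mu> (y + z)) B + measure (\<mu> (y - z)) B = 2 * measure (\<mu> y) B + 2 * measure (\<mu> z) B"
    if "B \<in> sets borel" for B
    using that by (simp add: measure_diagonal_add measure_diagonal_diff)
  have le: "measure (\<mu> (y + z)) B \<le> 2 * measure (\<mu> y) B + 2 * measure (\<mu> z) B"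
    "measure (\<mu> (y - z)) B \<le> 2 * measure (\<mu> y) B + 2 * measure (\<mu> z) B" if "B \<in> sets borel" for B
    using sum[OF that] measure_nonneg[of "\<mu> (y + z)" B] measure_nonneg[of "\<mu> (y - z)" B] by linarith+
  show "integrable (\<mu> (y + z)) f"
    by (rule integrable_diagonal_mono[OF f int, of 2 2]) (use le in simp_all)
  show "integrable (\<mu> (y - z)) f"
    by (rule integrable_diagonal_mono[OF f int, of 2 2]) (use le in simp_all)
qed

lemma domain_integrable:
  assumes "f \<in> borel_measurable borel" "x \<in> spectral_integral_domain E f"
  shows "integrable (\<mu> x) f"
proof (rule integrable_of_square_integrable[OF finite_diagonal_measure])
  show "f \<in> borel_measurable (\<mu> x)" using assms(1) by simp
  show "integrable (\<mu> x) (\<lambda>t. (f t)\<^sup>2)" using assms(2) by (simp add: spectral_integral_domain_def)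
qed

text \<open>Symmetry moves one \<open>E B\<close> across the inner product, and multiplicativity
  absorbs both copies.\<close>

lemma measure_diagonal_proj:
  assumes B: "B \<in> sets borel" and C: "C \<in> sets borel"
  shows "measure (\<mu> (E B x)) C = measure (\<mu> x) (C \<inter> B)"
proof -
  have CB: "C \<inter> B \<in> sets borel" using assms by auto
  have "E C (E B x) \<bullet> E B x = E B (E (C \<inter> B) x) \<bullet> x"
    using proj_sym[OF B, of "E (C \<inter> B) x" x] proj_Int[OF B C] by simp
  also have "E B (E (C \<inter> B) x) = E (C \<inter> B) x"
    using proj_Int[OF CB B] by (simp add: Int_absorb2 inf.coboundedI2 Int_commute)
  finally show ?thesis using C CB by (simp add: measure_diagonal_measure)
qed

lemma measure_diagonal_proj_le:
  assumes B: "B \<in> sets borel" and C: "C \<in> sets borel"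
  shows "measure (\<mu> (E B x)) C \<le> measure (\<mu> x) C"
  using B C by (simp add: measure_diagonal_proj sets_diagonal_measure
      finite_measure.finite_measure_mono[OF finite_diagonal_measure])

lemma domain_proj:
  assumes B: "B \<in> sets borel" and f: "f \<in> borel_measurable borel"
    and x: "x \<in> spectral_integral_domain E f"
  shows "E B x \<in> spectral_integral_domain E f"
  unfolding spectral_integral_domain_def mem_Collect_eq
proof (rule integrable_diagonal_mono[where y=x and z=x and c=1 and d=0])
  show "integrable (\<mu> x) (\<lambda>t. (f t)\<^sup>2)" "integrable (\<mu> x) (\<lambda>t. (f t)\<^sup>2)"
    using x by (simp_all add: spectral_integral_domain_def)
qed (use B f in \<open>simp_all add: measure_diagonal_proj_le\<close>)

text \<open>\<open>E B x\<close> has no spectral mass outside \<open>B\<close>, so a bound on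
  \<open>B\<close> suffices even when \<open>f\<close> is unbounded elsewhere.\<close>

lemma integrable_proj_bounded:
  fixes f :: "real \<Rightarrow> real"
  assumes B: "B \<in> sets borel" and f: "f \<in> borel_measurable borel"
    and bound: "\<And>t. t \<in> B \<Longrightarrow> \<bar>f t\<bar> \<le> K"
  shows "integrable (\<mu> (E B x)) f"
proof -
  interpret finite_measure "\<mu> (E B x)" by (rule finite_diagonal_measure)
  have "emeasure (\<mu> (E B x)) (- B) = 0"
    using B measure_diagonal_proj[OF B, of "- B" x]
    by (simp add: emeasure_eq_measure measure_diagonal_measure)
  then have "AE t in \<mu> (E B x). t \<in> B"
    using B by (intro AE_I[where N="- B"]) (auto simp: sets_diagonal_measure)
  then have "AE t in \<mu> (E B x). norm (f t) \<le> K" using bound by auto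
  then show ?thesis using f by (intro integrable_const_bound) auto
qed

lemma sum_list_diagonal_integral_eq_0:
  fixes f :: "real \<Rightarrow> real"
  assumes f: "f \<in> borel_measurable borel"
    and int: "\<And>c x. (c, x) \<in> set L \<Longrightarrow> integrable (\<mu> x) f"
    and eq: "\<And>B. B \<in> sets borel \<Longrightarrow> (\<Sum>p\<leftarrow>L. fst p * measure (\<mu> (snd p)) B) = 0"
  shows "(\<Sum>p\<leftarrow>L. fst p * integral\<^sup>L (\<mu> (snd p)) f) = 0"
  using sum_list_integral_eq_0[of "map (map_prod id \<mu>) L" borel f] f int eq
  by (fastforce simp: finite_diagonal_measure sets_diagonal_measure o_def)

section \<open>Spectral integrals and projections\<close>

lemma spectral_integral_inner_self:
  assumes f: "f \<in> borel_measurable borel" and xy: "(x, y) \<in> spectral_integral E f"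
  shows "y \<bullet> x = integral\<^sup>L (\<mu> x) f"
proof -
  have x: "x \<in> spectral_integral_domain E f" using xy by (auto simp: spectral_integral_def)
  note int = domain_integrable[OF f x]
  \<comment> \<open>The weak formula is used with \<open>z = x\<close>: the measure of
    \<open>x + x\<close> is four times that of \<open>x\<close>, and \<open>x - x\<close> is
    0.\<close>
  have "(\<Sum>p\<leftarrow>[(1, x + x), (-1, x - x), (-4, x)]. fst p * integral\<^sup>L (\<mu> (snd p)) f) = 0"
    using int integrable_diagonal_add_diff[OF f int int]
    by (intro sum_list_diagonal_integral_eq_0 f)
      (auto simp: measure_diagonal_add measure_diagonal_diff
        measure_diagonal_measure[of _ x] measure_diagonal_measure[of _ 0])
  moreover have "y \<bullet> x = ((\<integral>t. f t \<partial>\<mu> (x + x)) - (\<integral>t. f t \<partial>\<mu> (x - x))) / 4"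
    using xy x by (auto simp: spectral_integral_def)
  ultimately show ?thesis by simp
qed

text \<open>Symmetry moves \<open>E B\<close> from \<open>y\<close> to the test vector
  \<open>z\<close>, whose projection stays in the domain. By multiplicativity, the cross measure of
  \<open>x\<close> and \<open>E B z\<close> is that of \<open>E B x\<close> and
  \<open>z\<close>.\<close>

lemma spectral_integral_proj:
  assumes f: "f \<in> borel_measurable borel" and xy: "(x, y) \<in> spectral_integral E f"
    and B: "B \<in> sets borel"
  shows "(E B x, E B y) \<in> spectral_integral E f"
  unfolding spectral_integral_def mem_Collect_eq prod.case
proof (intro conjI ballI)
  have x: "x \<in> spectral_integral_domain E f" using xy by (auto simp: spectral_integral_def)
  then show Bx: "E B x \<in> spectral_integral_domain E f" by (rule domain_proj[OF B f])
  fix z assume z: "z \<in> spectral_integral_domain E f"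
  then have Bz: "E B z \<in> spectral_integral_domain E f" by (rule domain_proj[OF B f])
  note int = x[THEN domain_integrable[OF f]] Bx[THEN domain_integrable[OF f]]
    z[THEN domain_integrable[OF f]] Bz[THEN domain_integrable[OF f]]
  have C: "E C x \<bullet> E B z = E C (E B x) \<bullet> z" if "C \<in> sets borel" for C
    using proj_sym[OF B, of "E C x" z] proj_Int[OF B that] proj_Int[OF that B] by (simp add: Int_commute)
  have "E B y \<bullet> z = y \<bullet> E B z" using B by (rule proj_sym)
  also have "\<dots> = ((\<integral>t. f t \<partial>\<mu> (x + E B z)) - (\<integral>t. f t \<partial>\<mu> (x - E B z))) / 4"
    using xy Bz by (auto simp: spectral_integral_def)
  also have "\<dots> = ((\<integral>t. f t \<partial>\<mu> (E B x + z)) - (\<integral>t. f t \<partial>\<mu> (E B x - z))) / 4"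
  proof -
    \<comment> \<open>The signs cancel all quadratic terms and leave four times the difference of
      the two cross measures, which is 0 by \<open>C\<close>.\<close>
    have "(\<Sum>p\<leftarrow>[(1, x + E B z), (-1, x - E B z), (-1, E B x + z), (1, E B x - z)].
        fst p * integral\<^sup>L (\<mu> (snd p)) f) = 0"
      using integrable_diagonal_add_diff[OF f int(1,4)] integrable_diagonal_add_diff[OF f int(2,3)]
      by (intro sum_list_diagonal_integral_eq_0 f)
        (auto simp: measure_diagonal_add measure_diagonal_diff C)
    then show ?thesis by simp
  qed
  finally show "E B y \<bullet> z = ((\<integral>t. f t \<partial>\<mu> (E B x + z)) - (\<integral>t. f t \<partial>\<mu> (E B x - z))) / 4" .
qed

end

section \<open>The spectral measure of the inverse of a positive operator\<close>

text \<open>\<open>K\<close> plays the role of \<open>A\<^sup>* A\<close>.\<close>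

locale inverse_pvm = pvm E for E :: "real set \<Rightarrow> 'a::real_inner \<Rightarrow> 'a" +
  fixes K :: "'a \<Rightarrow> 'a"
  assumes graph: "spectral_integral E (\<lambda>t. t) = {(K v, v) | v. True}"
    and K_nonneg: "0 \<le> v \<bullet> K v"
begin

text \<open>Since \<open>K\<close> commutes with \<open>E\<close>, the form below is \<open>E B x \<bullet> K (E B x)\<close>, hence nonnegative.\<close>

definition \<kappa> :: "'a \<Rightarrow> real measure" where
  "\<kappa> x = measure_of UNIV (sets borel) (\<lambda>B. ennreal (E B x \<bullet> K x))"

text \<open>Projecting both components keeps a pair in the graph, and in a graph of pairs
  \<open>(K v, v)\<close> the second component determines the first.\<close>

lemma K_proj:
  assumes "B \<in> sets borel"
  shows "K (E B x) = E B (K x)"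
proof -
  have "(K x, x) \<in> spectral_integral E (\<lambda>t. t)" using graph by auto
  then have "(E B (K x), E B x) \<in> spectral_integral E (\<lambda>t. t)"
    using assms by (intro spectral_integral_proj) auto
  then show ?thesis using graph by auto
qed

lemma proj_inner_K_nonneg:
  assumes "B \<in> sets borel"
  shows "0 \<le> E B x \<bullet> K x"
  using K_nonneg[of "E B x"] assms proj_sym[OF assms, of "E B x" "K x"] by (simp add: K_proj proj_idem)

lemma sets_\<kappa> [measurable_cong]: "sets (\<kappa> x) = sets borel"
  unfolding \<kappa>_def using sets.sigma_sets_eq[of borel] by (simp add: sets_measure_of_conv)

lemma space_\<kappa> [simp]: "space (\<kappa> x) = UNIV"
  using sets_eq_imp_space_eq[OF sets_\<kappa>] by simp

lemma emeasure_\<kappa>: "B \<in> sets borel \<Longrightarrow> emeasure (\<kappa> x) B = ennreal (E B x \<bullet> K x)"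
  unfolding \<kappa>_def by (rule emeasure_form_measure) (simp_all add: proj_inner_K_nonneg)

lemma finite_\<kappa>: "finite_measure (\<kappa> x)"
  by (rule finite_measureI) (simp add: emeasure_\<kappa>)

text \<open>Boundedness of \<open>B\<close> puts \<open>E B x\<close> into the domain of the
  spectral integral of the identity, so it is an admissible test vector in the weak formula for the
  pair \<open>(K x, x)\<close>.\<close>

lemma
  assumes B: "B \<in> sets borel" and bound: "B \<subseteq> {-c..c}"
  shows integrable_\<kappa>_bounded: "integrable (\<kappa> x) (\<lambda>t. indicator B t * t)"
    and measure_diagonal_eq_integral_\<kappa>:
      "measure (\<mu> x) B = (\<integral>t. indicator B t * t \<partial>\<kappa> x)"
proof -
  interpret kappa: finite_measure "\<kappa> x" by (rule finite_\<kappa>)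
  have "norm (indicator B t * t) \<le> \<bar>c\<bar>" for t
    using bound by (auto simp: indicator_def subset_iff abs_le_iff)
  then show int: "integrable (\<kappa> x) (\<lambda>t. indicator B t * t)"
    using B by (intro kappa.integrable_const_bound[where B="\<bar>c\<bar>"] AE_I2) auto
  define u z where "u = K x" and "z = E B x"
  \<comment> \<open>Moving the indicator into the measure lets a single integrand, the identity,
    serve all three measures of the combination below.\<close>
  define \<rho> where "\<rho> = density (\<kappa> x) (\<lambda>t. ennreal (indicator B t))"
  have \<rho>_eq: "\<rho> = density (\<kappa> x) (indicator B)" by (simp add: \<rho>_def ennreal_indicator)
  have sets_\<rho>: "sets \<rho> = sets borel" by (simp add: \<rho>_def sets_\<kappa>)
  have em: "emeasure \<rho> C = ennreal (E (B \<inter> C) x \<bullet> K x)" if "C \<in> sets borel" for C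
    unfolding \<rho>_eq using B that by (subst emeasure_restricted) (auto simp: sets_\<kappa> emeasure_\<kappa>)
  have m: "measure \<rho> C = E (B \<inter> C) x \<bullet> K x" if "C \<in> sets borel" for C
    using B that by (simp add: measure_def em proj_inner_K_nonneg)
  have fin: "finite_measure \<rho>" by (rule finite_measureI) (simp add: em sets_eq_imp_space_eq[OF sets_\<rho>])
  have int_\<rho>: "integrable \<rho> (\<lambda>t. t)"
    unfolding \<rho>_def using B int by (subst integrable_density) auto
  have eq_\<rho>: "(\<integral>t. t \<partial>\<rho>) = (\<integral>t. indicator B t * t \<partial>\<kappa> x)"
    unfolding \<rho>_def using B by (subst integral_density) auto
  have ux: "(u, x) \<in> spectral_integral E (\<lambda>t. t)" unfolding u_def using graph by auto
  then have u: "u \<in> spectral_integral_domain E (\<lambda>t. t)" by (auto simp: spectral_integral_def)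
  have bnd: "\<bar>t\<^sup>2\<bar> \<le> c\<^sup>2" if "t \<in> B" for t
    using bound that by (auto intro!: abs_le_square_iff[THEN iffD1] simp: subset_iff)
  have z: "z \<in> spectral_integral_domain E (\<lambda>t. t)"
    unfolding spectral_integral_domain_def z_def using bnd
    by (auto intro!: integrable_proj_bounded[OF B, where K="c\<^sup>2"])
  have id: "(\<lambda>t::real. t) \<in> borel_measurable borel" by (rule measurable_ident_sets) simp
  have int_u: "integrable (\<mu> u) (\<lambda>t. t)" using id u by (rule domain_integrable)
  have int_z: "integrable (\<mu> z) (\<lambda>t. t)" using id z by (rule domain_integrable)
  have int_add: "integrable (\<mu> (u + z)) (\<lambda>t. t)"
    using id int_u int_z by (rule integrable_diagonal_add_diff(1))
  have int_diff: "integrable (\<mu> (u - z)) (\<lambda>t. t)"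
    using id int_u int_z by (rule integrable_diagonal_add_diff(2))
  \<comment> \<open>The polarized measure of \<open>u = K x\<close> and \<open>z = E B x\<close> is the restriction of \<open>\<kappa> x\<close> to \<open>B\<close>.\<close>
  have "(\<Sum>p\<leftarrow>[(1, \<mu> (u + z)), (-1, \<mu> (u - z)), (-4, \<rho>)]. fst p * (\<integral>t. t \<partial>snd p)) = 0"
  proof (rule sum_list_integral_eq_0[where N=borel])
    fix C :: "real set" assume C: "C \<in> sets borel"
    have "E C u \<bullet> z = E (B \<inter> C) x \<bullet> K x"
      unfolding u_def z_def
      using proj_sym[OF C, of "K x" "E B x"] proj_Int[OF B C]
      by (simp add: Int_commute inner_commute)
    then show "(\<Sum>p\<leftarrow>[(1, \<mu> (u + z)), (-1, \<mu> (u - z)), (-4, \<rho>)]. fst p * measure (snd p) C) = 0"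
      using C by (simp add: measure_diagonal_add measure_diagonal_diff m)
  qed (auto simp: int_add int_diff int_\<rho> fin sets_\<rho> finite_diagonal_measure sets_diagonal_measure)
  moreover have "x \<bullet> z = ((\<integral>t. t \<partial>\<mu> (u + z)) - (\<integral>t. t \<partial>\<mu> (u - z))) / 4"
    using ux z by (auto simp: spectral_integral_def)
  moreover have "measure (\<mu> x) B = x \<bullet> z"
    using B by (simp add: measure_diagonal_measure z_def inner_commute)
  ultimately show "measure (\<mu> x) B = (\<integral>t. indicator B t * t \<partial>\<kappa> x)"
    using eq_\<rho> by simp
qed

text \<open>On bounded sets the preceding integral formula applies. It gives a nonpositive value on
  sets of negative numbers, so these have measure 0, in accordance with \<open>ennreal\<close>
  vanishing there. Bounded pieces then exhaust \<open>B\<close>.\<close>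

lemma diagonal_measure_eq_density: "\<mu> x = density (\<kappa> x) ennreal"
proof (rule measure_eqI)
  show "sets (\<mu> x) = sets (density (\<kappa> x) ennreal)"
    by (simp add: sets_diagonal_measure sets_\<kappa>)
  interpret finite_measure "\<mu> x" by (rule finite_diagonal_measure)
  fix B assume "B \<in> sets (\<mu> x)"
  then have B[measurable]: "B \<in> sets borel" by (simp add: sets_diagonal_measure)
  have eq: "emeasure (\<mu> x) (B \<inter> {- real n..real n}) = emeasure (density (\<kappa> x) ennreal) (B \<inter> {- real n..real n})"
    for n
  proof -
    define N P where "N = B \<inter> {- real n..<0}" and "P = B \<inter> {0..real n}"
    have NP: "B \<inter> {- real n..real n} = N \<union> P" "N \<inter> P = {}" by (auto simp: N_def P_def)
    have [measurable]: "N \<in> sets borel" "P \<in> sets borel" by (auto simp: N_def P_def)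
    have "measure (\<mu> x) N = (\<integral>t. indicator N t * t \<partial>\<kappa> x)"
      by (rule measure_diagonal_eq_integral_\<kappa>[where c="real n"]) (auto simp: N_def)
    also have "\<dots> = - (\<integral>t. - (indicator N t * t) \<partial>\<kappa> x)" by simp
    also have "\<dots> \<le> 0"
      unfolding neg_le_0_iff_le by (rule Bochner_Integration.integral_nonneg) (auto simp: indicator_def N_def)
    finally have N: "emeasure (\<mu> x) N = 0"
      using measure_nonneg[of "\<mu> x" N] by (simp add: emeasure_eq_measure)
    have "emeasure (\<mu> x) (N \<union> P) = emeasure (\<mu> x) P"
      using plus_emeasure[of N "\<mu> x" P] NP N by (simp add: sets_diagonal_measure)
    also have "\<dots> = ennreal (\<integral>t. indicator P t * t \<partial>\<kappa> x)"
      unfolding emeasure_eq_measure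
      by (intro arg_cong[where f=ennreal] measure_diagonal_eq_integral_\<kappa>[where c="real n"]) (auto simp: P_def)
    also have "\<dots> = (\<integral>\<^sup>+t. ennreal (indicator P t * t) \<partial>\<kappa> x)"
      by (intro nn_integral_eq_integral[symmetric] integrable_\<kappa>_bounded[where c="real n"])
        (auto simp: P_def indicator_def)
    also have "\<dots> = (\<integral>\<^sup>+t. ennreal t * indicator (N \<union> P) t \<partial>\<kappa> x)"
      by (rule nn_integral_cong) (auto simp: N_def P_def indicator_def ennreal_neg)
    also have "\<dots> = emeasure (density (\<kappa> x) ennreal) (N \<union> P)"
      by (subst emeasure_density) (auto simp: sets_\<kappa>)
    finally show ?thesis using NP by simp
  qed
  have inc: "incseq (\<lambda>n. B \<inter> {- real n..real n})" by (auto simp: incseq_def)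
  have "\<exists>n. - real n \<le> t \<and> t \<le> real n" for t
    using real_arch_simple[of "\<bar>t\<bar>"] by (simp add: abs_le_iff neg_le_iff_le minus_le_iff conj_commute)
  then have UN: "(\<Union>n. B \<inter> {- real n..real n}) = B" by auto
  have "emeasure (\<mu> x) B = (SUP n. emeasure (\<mu> x) (B \<inter> {- real n..real n}))"
    by (subst SUP_emeasure_incseq[OF _ inc], unfold UN) (auto simp: sets_diagonal_measure)
  also have "\<dots> = (SUP n. emeasure (density (\<kappa> x) ennreal) (B \<inter> {- real n..real n}))"
    by (simp add: eq)
  also have "\<dots> = emeasure (density (\<kappa> x) ennreal) B"
    by (subst SUP_emeasure_incseq[OF _ inc], unfold UN) (auto simp: sets_\<kappa>)
  finally show "emeasure (\<mu> x) B = emeasure (density (\<kappa> x) ennreal) B" .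
qed

text \<open>All three quantities are integrals against \<open>\<kappa> h\<close>: its total mass is
  \<open>h \<bullet> K h\<close>, and the density \<open>t\<close> turns the squared norm into the
  integral of \<open>t\<close> and the form into that of \<open>t * chi t\<close> over
  \<open>t > 0\<close>. Integrating the scalar bound thus avoids division by the spectral
  variable.\<close>

lemma spectral_interpolation:
  assumes chi: "index_function chi" and a: "a \<ge> 0" and k: "k \<ge> 0"
    and le: "\<And>l. l > 0 \<Longrightarrow> l \<le> a + k * (l * chi l)"
    and hy: "(h, y) \<in> spectral_integral E (\<lambda>t. indicator {0<..} t * chi t)"
  shows "0 \<le> h \<bullet> y" and "(norm h)\<^sup>2 \<le> a * (h \<bullet> K h) + k * (h \<bullet> y)"
proof -
  define f where "f t = indicator {0<..} t * chi t" for t :: real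
  have f[measurable]: "f \<in> borel_measurable borel"
    using borel_measurable_continuous_on_indicator[of "{0<..}" chi] chi
    unfolding f_def[abs_def] by (simp add: index_function_def)
  have f0: "f t \<ge> 0" for t
    using chi by (auto simp: f_def index_function_def indicator_def less_imp_le)
  have hy': "(h, y) \<in> spectral_integral E f" using hy by (simp add: f_def[abs_def])
  have "h \<in> spectral_integral_domain E f" using hy' by (auto simp: spectral_integral_def)
  then have int: "integrable (\<mu> h) f" by (rule domain_integrable[OF f])
  have eq: "h \<bullet> y = integral\<^sup>L (\<mu> h) f"
    using spectral_integral_inner_self[OF f hy'] by (simp add: inner_commute)
  then show y0: "0 \<le> h \<bullet> y" using f0 by simp
  have "ennreal ((norm h)\<^sup>2) = emeasure (\<mu> h) UNIV"
    by (simp add: emeasure_diagonal_measure power2_norm_eq_inner)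
  also have "\<dots> = (\<integral>\<^sup>+t. ennreal t \<partial>\<kappa> h)"
    unfolding diagonal_measure_eq_density by (subst emeasure_density) (auto simp: sets_\<kappa>)
  also have "\<dots> \<le> (\<integral>\<^sup>+t. ennreal a + ennreal k * (ennreal t * ennreal (f t)) \<partial>\<kappa> h)"
  proof (rule nn_integral_mono)
    fix t :: real
    show "ennreal t \<le> ennreal a + ennreal k * (ennreal t * ennreal (f t))"
    \<comment> \<open>For \<open>t \<le> 0\<close> the left-hand side is 0 in
      \<open>ennreal\<close>; the scalar bound enters only on the positive half-line.\<close>
    proof (cases "t > 0")
      case True
      then have "ennreal t \<le> ennreal (a + k * (t * f t))"
        using le[of t] by (intro ennreal_leI) (simp add: f_def)
      then show ?thesis using a k f0 True by (simp add: ennreal_mult')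
    qed (simp add: ennreal_neg)
  qed
  also have "\<dots> = ennreal a * emeasure (\<kappa> h) UNIV + ennreal k * (\<integral>\<^sup>+t. ennreal t * ennreal (f t) \<partial>\<kappa> h)"
    by (simp add: nn_integral_add nn_integral_cmult)
  also have "(\<integral>\<^sup>+t. ennreal t * ennreal (f t) \<partial>\<kappa> h) = (\<integral>\<^sup>+t. ennreal (f t) \<partial>\<mu> h)"
    unfolding diagonal_measure_eq_density by (subst nn_integral_density) auto
  also have "\<dots> = ennreal (h \<bullet> y)"
    using int f0 eq by (simp add: nn_integral_eq_integral)
  also have "ennreal a * emeasure (\<kappa> h) UNIV + ennreal k * ennreal (h \<bullet> y)
      = ennreal (a * (h \<bullet> K h) + k * (h \<bullet> y))"
    using a k y0 K_nonneg by (simp add: emeasure_\<kappa> ennreal_mult' ennreal_plus)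
  finally show "(norm h)\<^sup>2 \<le> a * (h \<bullet> K h) + k * (h \<bullet> y)"
    using a k y0 K_nonneg by (subst (asm) ennreal_le_iff) auto
qed

end

section \<open>From the spectral inequality to the modulus of continuity\<close>

theorem proposition3p1:
  fixes A :: "'a::{real_inner, complete_space} \<Rightarrow> 'b::{real_inner, complete_space}"
    and \<Psi> chi :: "real \<Rightarrow> real"
    and R :: real
  assumes "separable_space (euclidean :: 'a topology)"
    and "infinite_dimensional TYPE('a)"
    and "separable_space (euclidean :: 'b topology)"
    and "infinite_dimensional TYPE('b)"
    and "bounded_linear A"
    and "inj A"
    and "\<not> closed (range A)"
    and "index_function \<Psi>"
    and "concave_on {0<..} \<Psi>"
    and "strict_mono_on {0<..} \<Psi>"
    and "(\<Psi> \<longlongrightarrow> 0) (at_right 0)"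
    and "filterlim \<Psi> at_top at_top"
    and "((\<lambda>t. \<Psi> t / t) \<longlongrightarrow> 0) at_top"
    and "index_function chi"
    and "\<And>t. t > 0 \<Longrightarrow> chi t \<ge> the_inv_into {0<..} \<Psi> t / t"
    and "R > 0"
  shows "\<forall>\<delta>>0. modulus_of_continuity A (scale_ball (normal_operator_inverse A) chi R) \<delta>
           \<le> ereal (\<delta> * sqrt (\<Psi> (R\<^sup>2 / \<delta>\<^sup>2)))"
proof (intro allI impI)
  fix \<delta> :: real assume \<delta>: "\<delta> > 0"
  interpret A: bounded_linear A by fact
  define T where "T = normal_operator_inverse A"
  define K where "K v = adjoint A (A v)" for v
  define s where "s = R\<^sup>2 / \<delta>\<^sup>2"
  have s: "s > 0" using \<delta> \<open>R > 0\<close> by (simp add: s_def)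
  have \<Psi>_pos: "\<And>t. t > 0 \<Longrightarrow> \<Psi> t > 0" using \<open>index_function \<Psi>\<close> by (simp add: index_function_def)
  obtain a k where a: "a \<ge> 0" and k: "k \<ge> 0" and ak: "a + k * s = \<Psi> s"
    and line: "\<And>t. t > 0 \<Longrightarrow> \<Psi> t \<le> a + k * t"
    using concave_supporting_line[OF \<open>concave_on {0<..} \<Psi>\<close> \<open>strict_mono_on {0<..} \<Psi>\<close> \<Psi>_pos s] by blast
  \<comment> \<open>The supporting line is read at the \<open>t\<close> with
    \<open>\<Psi> t = l\<close>, where the bound on \<open>chi\<close> becomes
    \<open>t \<le> l * chi l\<close>.\<close>
  have le: "l \<le> a + k * (l * chi l)" if l: "l > 0" for l
  proof -
    obtain t where t: "t > 0" "\<Psi> t = l"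
      using index_function_surj[OF \<open>index_function \<Psi>\<close> \<open>(\<Psi> \<longlongrightarrow> 0) (at_right 0)\<close>
          \<open>filterlim \<Psi> at_top at_top\<close> l] by blast
    have "the_inv_into {0<..} \<Psi> l = t"
      using t the_inv_into_f_f[of \<Psi> "{0<..}" t] \<open>strict_mono_on {0<..} \<Psi>\<close>
      by (auto dest: strict_mono_on_imp_inj_on)
    then have "t / l \<le> chi l" using assms(15)[OF l] by simp
    then have "t \<le> l * chi l" using l by (simp add: field_simps)
    then have "k * t \<le> k * (l * chi l)" using k by (rule mult_left_mono)
    then show ?thesis using line[OF t(1)] t(2) by simp
  qed
  have KA: "v \<bullet> K v = (norm (A v))\<^sup>2" for v
    using inner_adjoint[OF \<open>bounded_linear A\<close>] by (simp add: K_def power2_norm_eq_inner)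
  have interp: "0 \<le> form_norm T chi h \<and>
      (norm h)\<^sup>2 \<le> a * (norm (A h))\<^sup>2 + k * (form_norm T chi h)\<^sup>2"
    if "h \<in> Domain (spectral_calculus chi T)" for h
  proof -
    define y where "y = op_apply (spectral_calculus chi T) h"
    have "(h, y) \<in> spectral_calculus chi T"
      unfolding y_def op_apply_def using that by (metis DomainE someI)
    then obtain E where E: "spectral_measure_of E T"
      and hy: "(h, y) \<in> spectral_integral E (\<lambda>t. indicator {0<..} t * chi t)"
      by (auto simp: spectral_calculus_def)
    interpret inverse_pvm E K
      using E KA by unfold_locales
        (auto simp: spectral_measure_of_def T_def normal_operator_inverse_def K_def)
    note I = spectral_interpolation[OF \<open>index_function chi\<close> a k le hy]
    have "(form_norm T chi h)\<^sup>2 = h \<bullet> y" "0 \<le> form_norm T chi h"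
      using I(1) by (simp_all add: form_norm_def y_def)
    then show ?thesis using I(2) by (simp add: KA)
  qed
  have "norm x \<le> \<delta> * sqrt (\<Psi> s)" if x: "x \<in> scale_ball T chi R" and Ax: "norm (A x) \<le> \<delta>" for x
  proof -
    \<comment> \<open>The value chosen by \<open>scale_norm\<close> is a genuine limit of form
      norms, and the sequence realizing it carries the estimate to \<open>x\<close>.\<close>
    obtain r where "has_scale_norm T chi x r" "r \<le> R"
      using x someI_ex[of "has_scale_norm T chi x"]
      by (auto simp: scale_ball_def scale_space_def scale_norm_def)
    then obtain h where h: "\<And>n. h n \<in> Domain (spectral_calculus chi T)" "h \<longlonglongrightarrow> x"
      and r: "(\<lambda>n. form_norm T chi (h n)) \<longlonglongrightarrow> r"
      by (auto simp: has_scale_norm_def)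
    \<comment> \<open>This allows \<open>r \<le> R\<close> to be squared below.\<close>
    have "r \<ge> 0" by (rule LIMSEQ_le_const[OF r]) (use interp h in auto)
    have "(norm x)\<^sup>2 \<le> a * (norm (A x))\<^sup>2 + k * r\<^sup>2"
    proof (rule LIMSEQ_le)
      show "(\<lambda>n. (norm (h n))\<^sup>2) \<longlonglongrightarrow> (norm x)\<^sup>2" by (intro tendsto_intros h)
      show "(\<lambda>n. a * (norm (A (h n)))\<^sup>2 + k * (form_norm T chi (h n))\<^sup>2)
          \<longlonglongrightarrow> a * (norm (A x))\<^sup>2 + k * r\<^sup>2"
        by (intro tendsto_intros A.tendsto h r)
    qed (use interp h in auto)
    also have "\<dots> \<le> a * \<delta>\<^sup>2 + k * R\<^sup>2"
      using a k Ax \<open>r \<ge> 0\<close> \<open>r \<le> R\<close> by (intro add_mono mult_left_mono power_mono) auto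
    \<comment> \<open>Since \<open>R\<^sup>2 = \<delta>\<^sup>2 * s\<close>, the line is evaluated
      exactly at its point of contact with \<open>\<Psi>\<close>.\<close>
    also have "\<dots> = \<delta>\<^sup>2 * (a + k * s)" using \<delta> by (simp add: s_def field_simps)
    also have "\<dots> = (\<delta> * sqrt (\<Psi> s))\<^sup>2"
      using \<Psi>_pos[OF s] by (simp add: ak power_mult_distrib)
    finally show ?thesis using \<delta> \<Psi>_pos[OF s] by (auto intro: power2_le_imp_le)
  qed
  then show "modulus_of_continuity A (scale_ball (normal_operator_inverse A) chi R) \<delta>
      \<le> ereal (\<delta> * sqrt (\<Psi> (R\<^sup>2 / \<delta>\<^sup>2)))"
    unfolding modulus_of_continuity_def T_def s_def by (auto intro!: SUP_least)
qed

end
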